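(* Let $\lambda$ be a nonzero real number, $k\in\mathbb{Z}$, and let $Y$ be a random variable whose moment generating function $E[e^{Yt}]$ exists for $|t|<r$ for some $r>0$. For every positive integer $n$, $$\sum_{m=1}^{n}\binom{n}{m}\mathrm{Bel}_{m,\lambda}^{(k-1,Y)}(x)\,E\big[Y(Y-\lambda)_{n-m,\lambda}\big]=\sum_{m=0}^{n-1}\binom{n}{m}\mathrm{Bel}_{m+1,\lambda}^{(k,Y)}(x)\,E\big[(Y)_{n-m,\lambda}\big].$$
   Context: Degenerate falling factorial: $(x)_{0,\lambda}=1$, $(x)_{n,\lambda}=x(x-\lambda)\cdots(x-(n-1)\lambda)$ for $n\ge1$. Degenerate exponential: $e_\lambda^x(t)=(1+\lambda t)^{x/\lambda}=\sum_{n\ge0}(x)_{n,\lambda}\frac{t^n}{n!}$. For $k\in\mathbb{Z}$, $\mathrm{Ei}_{k,\lambda}(x)=\sum_{n=1}^{\infty}\frac{(1)_{n,\lambda}}{(n-1)!\,n^{k}}x^{n}$. The probabilistic degenerate poly-Bell polynomials $\mathrm{Bel}_{n,\lambda}^{(k,Y)}(x)$ are defined for each $k\in\mathbb{Z}$ by $\mathrm{Ei}_{k,\lambda}\big(x(E[e_\lambda^Y(t)]-1)\big)=\sum_{n=1}^{\infty}\mathrm{Bel}_{n,\lambda}^{(k,Y)}(x)\frac{t^n}{n!}$ (power series in $t$), with $\mathrm{Bel}_{0,\lambda}^{(k,Y)}(x)=1$. *)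

theory Defs
  imports "HOL-Probability.Probability"
begin

definition degen_ffact :: "real \<Rightarrow> real \<Rightarrow> nat \<Rightarrow> real" where
  "degen_ffact lam x n = (\<Prod>i<n. x - real i * lam)"

definition degen_exp :: "real \<Rightarrow> real \<Rightarrow> real \<Rightarrow> real" where
  "degen_exp lam x t = (1 + lam * t) powr (x / lam)"

text \<open>The summation index is shifted by one, since the series starts at exponent 1.\<close>

definition degen_poly_Ei :: "int \<Rightarrow> real \<Rightarrow> real \<Rightarrow> real" where
  "degen_poly_Ei k lam z =
     (\<Sum>j. degen_ffact lam 1 (Suc j) / (fact j * real (Suc j) powi k) * z ^ Suc j)"

text \<open>
  The sequence \<open>B\<close> is determined by its exponential generating function: \<^const>\<open>has_fps_expansion\<close>
  says that the genuine function of \<open>t\<close> on the left equals the convergent power series on the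
  right for all \<open>t\<close> in a neighbourhood of 0. The generating function has no constant term; the
  value at index 0 is set to 1 by convention.
\<close>

definition prob_degen_poly_Bell ::
    "'a measure \<Rightarrow> ('a \<Rightarrow> real) \<Rightarrow> real \<Rightarrow> int \<Rightarrow> nat \<Rightarrow> real \<Rightarrow> real" where
  "prob_degen_poly_Bell M Y lam k n x =
     (THE B :: nat \<Rightarrow> real. B 0 = 1 \<and>
        (\<lambda>t. degen_poly_Ei k lam (x * ((\<integral>\<omega>. degen_exp lam (Y \<omega>) t \<partial>M) - 1)))
          has_fps_expansion Abs_fps (\<lambda>m. if m = 0 then 0 else B m / fact m)) n"

end

theory Submission
  imports Defs "HOL-Complex_Analysis.Laurent_Convergence"
begin

text \<open>
  Write \<open>F(t) = E[e\<^sub>\<lambda>\<^sup>Y(t)] - 1\<close> and \<open>G\<^sub>k(t) = Ei\<^sub>k(x F(t))\<close>. Since \<open>z Ei\<^sub>k'(z) = Ei\<^sub>k\<^sub>-\<^sub>1(z)\<close>, the chain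
  rule gives \<open>G\<^sub>k\<^sub>-\<^sub>1 F' = G\<^sub>k' F\<close>, and the claim compares the coefficients of \<open>t\<^sup>n\<close>. On the
  analytic side, \<open>F\<close> expands at 0 with coefficients \<open>E[(Y)\<^sub>n\<^sub>,\<^sub>\<lambda>] / n!\<close> by dominated summation of
  the binomial series, and expansions at 0 are stable under composition.
\<close>

section \<open>Uniqueness and composition of real power series expansions\<close>

text \<open>Evaluation at 0 fixes the constant coefficient, and differentiating both expansions
  moves the next coefficient down by one; hence the induction lets \<open>f\<close>,
  \<open>F\<close> and \<open>G\<close> vary.\<close>

lemma has_fps_expansion_unique_real:
  fixes f :: "real \<Rightarrow> real"
  assumes "f has_fps_expansion F" "f has_fps_expansion G"
  shows "F = G"
proof (rule fps_ext)
  fix n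
  show "fps_nth F n = fps_nth G n"
    using assms
  proof (induction n arbitrary: f F G)
    case 0
    then show ?case
      by (auto simp: has_fps_expansion_def eval_fps_at_0 dest!: eventually_nhds_x_imp_x)
  next
    case (Suc n)
    have "fps_nth (fps_deriv F) n = fps_nth (fps_deriv G) n"
      by (rule Suc.IH[OF has_fps_expansion_deriv has_fps_expansion_deriv, OF Suc.prems])
    then show ?case by simp
  qed
qed

text \<open>
  Composition of expansions is available only for complex functions, so real series are
  transported to complex ones.
\<close>

definition fps_complex_of_real :: "real fps \<Rightarrow> complex fps" where
  "fps_complex_of_real F = Abs_fps (\<lambda>n. of_real (fps_nth F n))"

lemma fps_nth_complex_of_real [simp]: "fps_nth (fps_complex_of_real F) n = of_real (fps_nth F n)"
  by (simp add: fps_complex_of_real_def)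

lemma fps_conv_radius_complex_of_real [simp]:
  "fps_conv_radius (fps_complex_of_real F) = fps_conv_radius F"
  by (simp add: fps_conv_radius_def conv_radius_def)

lemma eval_fps_complex_of_real:
  assumes "ereal \<bar>t\<bar> < fps_conv_radius F"
  shows "eval_fps (fps_complex_of_real F) (of_real t) = of_real (eval_fps F t)"
proof -
  have "(\<lambda>n. fps_nth F n * t ^ n) sums eval_fps F t"
    using assms by (intro sums_eval_fps) simp
  then have "(\<lambda>n. of_real (fps_nth F n * t ^ n)) sums complex_of_real (eval_fps F t)"
    by (rule sums_of_real)
  then show ?thesis
    by (simp add: eval_fps_def sums_iff)
qed

lemma fps_complex_of_real_mult:
  "fps_complex_of_real (F * G) = fps_complex_of_real F * fps_complex_of_real G"
  by (rule fps_ext) (simp add: fps_mult_nth)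

lemma fps_complex_of_real_power: "fps_complex_of_real (F ^ n) = fps_complex_of_real F ^ n"
proof (induction n)
  case 0
  show ?case by (rule fps_ext) simp
next
  case (Suc n)
  then show ?case by (simp add: fps_complex_of_real_mult)
qed

lemma fps_complex_of_real_compose:
  "fps_complex_of_real (fps_compose F G) =
   fps_compose (fps_complex_of_real F) (fps_complex_of_real G)"
  by (rule fps_ext) (simp add: fps_compose_nth flip: fps_complex_of_real_power)

lemma eventually_norm_less_fps_conv_radius:
  fixes F :: "'a :: {banach, real_normed_div_algebra} fps"
  assumes "fps_conv_radius F > 0"
  shows "eventually (\<lambda>z :: 'a. ereal (norm z) < fps_conv_radius F) (nhds 0)"
proof -
  have "eventually (\<lambda>z :: 'a. z \<in> eball 0 (fps_conv_radius F)) (nhds 0)"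
    using assms by (intro eventually_nhds_in_open) (auto simp: zero_ereal_def)
  then show ?thesis by simp
qed

text \<open>The complex composition theorem is applied to the sums of the transported series. On the
  real axis near 0 these sums agree with \<open>f\<close> and \<open>g\<close>, and injectivity of
  \<open>of_real\<close> brings the identity back.\<close>

lemma has_fps_expansion_compose_real:
  fixes f g :: "real \<Rightarrow> real"
  assumes F: "f has_fps_expansion F" and G: "g has_fps_expansion G" "fps_nth G 0 = 0"
  shows "(\<lambda>t. f (g t)) has_fps_expansion fps_compose F G"
proof -
  let ?c = fps_complex_of_real
  have rad: "fps_conv_radius F > 0" "fps_conv_radius G > 0"
    using F G by (auto simp: has_fps_expansion_def)
  have "(eval_fps (?c F) \<circ> eval_fps (?c G)) has_fps_expansion fps_compose (?c F) (?c G)"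
    using rad G(2) by (intro has_fps_expansion_compose eval_fps_has_fps_expansion) auto
  then have C: "(eval_fps (?c F) \<circ> eval_fps (?c G)) has_fps_expansion ?c (fps_compose F G)"
    by (simp add: fps_complex_of_real_compose)
  \<comment> \<open>Transport preserves the radius of convergence, so the complex copy yields
    positivity for the real composite.\<close>
  have radFG: "fps_conv_radius (fps_compose F G) > 0"
    using C by (simp add: has_fps_expansion_def)
  have lim0: "filterlim complex_of_real (nhds 0) (nhds 0)"
    using tendsto_of_real[OF filterlim_ident, of "0::real", where ?'a = complex] by simp
  have evC: "eventually (\<lambda>t. eval_fps (?c (fps_compose F G)) (of_real t) =
               eval_fps (?c F) (eval_fps (?c G) (of_real t))) (nhds (0::real))"
    using C unfolding has_fps_expansion_def
    by (auto dest: filterlim_iff[THEN iffD1, OF lim0, rule_format])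
  have g0: "g 0 = 0"
    using G by (auto simp: has_fps_expansion_def eval_fps_at_0 dest!: eventually_nhds_x_imp_x)
  have "isCont g 0"
    using has_fps_expansion_imp_continuous[OF G(1), of UNIV] by simp
  then have limg: "filterlim g (nhds 0) (nhds 0)"
    using g0 by (metis continuous_at_imp_continuous_within isCont_def tendsto_nhds_iff)
  have ev1: "eventually (\<lambda>t. eval_fps F (g t) = f (g t)) (nhds 0)"
    using F limg by (auto simp: has_fps_expansion_def filterlim_iff)
  \<comment> \<open>The transported \<open>F\<close> can be evaluated at \<open>g t\<close> as a
    real sum only inside the disc of convergence, which \<open>g t\<close> enters by continuity and
    \<open>g 0 = 0\<close>.\<close>
  have ev2: "eventually (\<lambda>t. ereal (norm (g t)) < fps_conv_radius F) (nhds 0)"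
    using eventually_norm_less_fps_conv_radius[OF rad(1)] limg
    by (auto simp: filterlim_iff)
  have ev3: "eventually (\<lambda>t. eval_fps G t = g t) (nhds 0)"
    using G by (auto simp: has_fps_expansion_def)
  have "eventually (\<lambda>t. eval_fps (fps_compose F G) t = f (g t)) (nhds 0)"
    using evC ev1 ev2 ev3 eventually_norm_less_fps_conv_radius[OF rad(2)]
      eventually_norm_less_fps_conv_radius[OF radFG]
  proof eventually_elim
    case (elim t)
    have "complex_of_real (eval_fps (fps_compose F G) t) =
          eval_fps (?c F) (eval_fps (?c G) (of_real t))"
      using elim by (simp add: eval_fps_complex_of_real)
    also have "\<dots> = of_real (f (g t))"
      using elim by (simp add: eval_fps_complex_of_real)
    finally show ?case by (simp only: of_real_eq_iff)
  qed
  with radFG show ?thesis by (simp add: has_fps_expansion_def)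
qed

section \<open>Degenerate falling factorials and the binomial series\<close>

lemma degen_ffact_0 [simp]: "degen_ffact lam y 0 = 1"
  by (simp add: degen_ffact_def)

lemma degen_ffact_Suc_shift: "degen_ffact lam y (Suc n) = y * degen_ffact lam (y - lam) n"
  unfolding degen_ffact_def prod.lessThan_Suc_shift
  by (simp add: algebra_simps)

text \<open>The triangle inequality bounds each factor by
  \<open>\<bar>y\<bar> + real i * \<bar>lam\<bar>\<close>. The product of these bounds later serves
  as a majorant under the expectation.\<close>

lemma abs_degen_ffact_le: "\<bar>degen_ffact lam y n\<bar> \<le> degen_ffact (- \<bar>lam\<bar>) \<bar>y\<bar> n"
  unfolding degen_ffact_def abs_prod
proof (rule prod_mono, safe)
  fix i
  have "\<bar>y - real i * lam\<bar> \<le> \<bar>y\<bar> + \<bar>real i * lam\<bar>" by (rule abs_triangle_ineq4)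
  then show "\<bar>y - real i * lam\<bar> \<le> \<bar>y\<bar> - real i * - \<bar>lam\<bar>" by (simp add: abs_mult)
qed simp

text \<open>Pulling \<open>lam\<close> out of every factor turns the degenerate exponential series
  into Newton's binomial series in \<open>lam * t\<close> with exponent
  \<open>y / lam\<close>.\<close>

lemma degen_ffact_eq_gbinomial:
  assumes "lam \<noteq> 0"
  shows "degen_ffact lam y n / fact n = (y / lam gchoose n) * lam ^ n"
proof -
  have "degen_ffact lam y n = (\<Prod>i<n. (y / lam - real i) * lam)"
    unfolding degen_ffact_def using assms by (intro prod.cong) (auto simp: field_simps)
  then show ?thesis
    by (simp add: prod.distrib gbinomial_prod_rev atLeast0LessThan)
qed

lemma degen_exp_sums:
  assumes "lam \<noteq> 0" "\<bar>lam * t\<bar> < 1"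
  shows "(\<lambda>n. degen_ffact lam y n / fact n * t ^ n) sums degen_exp lam y t"
  using gen_binomial_real[OF assms(2), of "y / lam"] assms(1)
  by (simp add: degen_ffact_eq_gbinomial degen_exp_def power_mult_distrib mult.assoc)

section \<open>The power series of the degenerate polyexponential function\<close>

text \<open>The index is unshifted here. The constant term is set apart because for
  \<open>k = 0\<close> the general formula would give 1 there, as
  \<open>0 powi 0 = 1\<close>.\<close>

definition degen_poly_Ei_fps :: "int \<Rightarrow> real \<Rightarrow> real fps" where
  "degen_poly_Ei_fps k lam = Abs_fps (\<lambda>n. if n = 0 then 0
     else degen_ffact lam 1 n / (fact (n - 1) * real n powi k))"

text \<open>The operator \<open>z d/dz\<close> multiplies the \<open>n\<close>-th coefficient by
  \<open>n\<close>, which lowers the exponent of \<open>n\<close> in the denominator by one.\<close>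

lemma degen_poly_Ei_fps_pred:
  "degen_poly_Ei_fps (k - 1) lam = fps_X * fps_deriv (degen_poly_Ei_fps k lam)"
proof (rule fps_ext)
  fix n
  show "fps_nth (degen_poly_Ei_fps (k - 1) lam) n =
        fps_nth (fps_X * fps_deriv (degen_poly_Ei_fps k lam)) n"
    by (cases n) (auto simp: degen_poly_Ei_fps_def power_int_diff)
qed

text \<open>Two-sided induction from \<open>k = 1\<close>, where \<open>(n-1)! * n = n!\<close>
  gives the series of \<open>degen_exp lam 1 t - 1\<close>. Going up divides the coefficients by
  \<open>n \<ge> 1\<close>; going down differentiates and multiplies by \<open>fps_X\<close>.
  Neither shrinks the radius.\<close>

lemma fps_conv_radius_degen_poly_Ei_pos:
  assumes "lam \<noteq> 0"
  shows "fps_conv_radius (degen_poly_Ei_fps k lam) > 0"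
proof (induction k rule: int_induct[where k = 1])
  case base
  have "(\<lambda>t. degen_exp lam 1 t - 1) has_fps_expansion degen_poly_Ei_fps 1 lam"
  proof (rule has_fps_expansionI)
    have "eventually (\<lambda>t. t \<in> ball 0 (1 / \<bar>lam\<bar>)) (nhds (0::real))"
      using assms by (intro eventually_nhds_in_open) auto
    then show "eventually (\<lambda>t. (\<lambda>n. fps_nth (degen_poly_Ei_fps 1 lam) n * t ^ n) sums
                 (degen_exp lam 1 t - 1)) (nhds 0)"
    proof eventually_elim
      case (elim t)
      then have "\<bar>lam * t\<bar> < 1"
        using assms by (simp add: abs_mult field_simps)
      from degen_exp_sums[OF assms this, of 1]
      have "(\<lambda>n. degen_ffact lam 1 (Suc n) / fact (Suc n) * t ^ Suc n) sums (degen_exp lam 1 t - 1)"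
        by (subst sums_Suc_iff) simp
      then have "(\<lambda>n. fps_nth (degen_poly_Ei_fps 1 lam) (Suc n) * t ^ Suc n) sums
                   (degen_exp lam 1 t - 1)"
        by (simp add: degen_poly_Ei_fps_def mult_ac)
      then show ?case
        by (intro sums_Suc_imp[of "\<lambda>n. fps_nth (degen_poly_Ei_fps 1 lam) n * t ^ n"]) (simp_all add: degen_poly_Ei_fps_def)
    qed
  qed
  then show ?case by (simp add: has_fps_expansion_def)
next
  case (step1 k)
  have "fps_conv_radius (degen_poly_Ei_fps k lam) \<le> fps_conv_radius (degen_poly_Ei_fps (k + 1) lam)"
    unfolding fps_conv_radius_def
  proof (rule conv_radius_geI_ex')
    fix t :: real
    assume t: "0 < t" "ereal t < conv_radius (fps_nth (degen_poly_Ei_fps k lam))"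
    have "summable (\<lambda>n. norm (fps_nth (degen_poly_Ei_fps k lam) n * t ^ n))"
      using t by (intro abs_summable_in_conv_radius) simp
    moreover have "norm (fps_nth (degen_poly_Ei_fps (k + 1) lam) n * t ^ n) \<le>
        norm (fps_nth (degen_poly_Ei_fps k lam) n * t ^ n)" for n
    proof (cases "n = 0")
      case False
      have "fps_nth (degen_poly_Ei_fps k lam) n = real n * fps_nth (degen_poly_Ei_fps (k + 1) lam) n"
        using False by (simp add: degen_poly_Ei_fps_def power_int_add)
      moreover have "1 * \<bar>fps_nth (degen_poly_Ei_fps (k + 1) lam) n\<bar> \<le>
          real n * \<bar>fps_nth (degen_poly_Ei_fps (k + 1) lam) n\<bar>"
        using False by (intro mult_right_mono) auto
      ultimately show ?thesis
        using t by (simp add: abs_mult mult_right_mono)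
    qed (simp add: degen_poly_Ei_fps_def)
    ultimately show "summable (\<lambda>n. fps_nth (degen_poly_Ei_fps (k + 1) lam) n * of_real t ^ n)"
      by (simp only: of_real_eq_id id_apply) (rule summable_comparison_test'[where N = 0])
  qed
  with step1 show ?case by simp
next
  case (step2 k)
  have "0 < min (fps_conv_radius (fps_X :: real fps))
              (fps_conv_radius (fps_deriv (degen_poly_Ei_fps k lam)))"
    using step2 fps_conv_radius_deriv[of "degen_poly_Ei_fps k lam"] by simp
  also have "\<dots> \<le> fps_conv_radius (fps_X * fps_deriv (degen_poly_Ei_fps k lam))"
    by (rule fps_conv_radius_mult)
  finally show ?case by (simp add: degen_poly_Ei_fps_pred)
qed

lemma degen_poly_Ei_has_fps_expansion:
  assumes "lam \<noteq> 0"
  shows "degen_poly_Ei k lam has_fps_expansion degen_poly_Ei_fps k lam"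
proof (rule has_fps_expansionI)
  show "eventually (\<lambda>z. (\<lambda>n. fps_nth (degen_poly_Ei_fps k lam) n * z ^ n) sums
          degen_poly_Ei k lam z) (nhds 0)"
    using eventually_norm_less_fps_conv_radius[OF fps_conv_radius_degen_poly_Ei_pos[OF assms, of k]]
  proof eventually_elim
    case (elim z)
    let ?c = "\<lambda>n. fps_nth (degen_poly_Ei_fps k lam) n * z ^ n"
    have "summable ?c" by (rule summable_fps) fact
    then have "summable (\<lambda>n. ?c (Suc n))" by (subst summable_Suc_iff)
    then have "(\<lambda>n. ?c (Suc n)) sums (\<Sum>n. ?c (Suc n))" by (rule summable_sums)
    also have "(\<Sum>n. ?c (Suc n)) = degen_poly_Ei k lam z"
      unfolding degen_poly_Ei_def by (simp add: degen_poly_Ei_fps_def)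
    finally show ?case
      by (intro sums_Suc_imp[of ?c]) (simp_all add: degen_poly_Ei_fps_def)
  qed
qed

section \<open>Expectation of the degenerate exponential\<close>

context
  fixes M :: "'a measure" and Y :: "'a \<Rightarrow> real" and lam r :: real
  assumes prob: "prob_space M"
    and meas [measurable]: "Y \<in> borel_measurable M"
    and r: "r > 0"
    and mgf: "\<And>t :: real. \<bar>t\<bar> < r \<Longrightarrow> integrable M (\<lambda>\<omega>. exp (Y \<omega> * t))"
    and lam: "lam \<noteq> 0"
begin

lemma degen_ffact_measurable: "(\<lambda>\<omega>. degen_ffact lam (Y \<omega>) n) \<in> borel_measurable M"
  unfolding degen_ffact_def by measurable

text \<open>
  Replacing \<open>\<lambda>\<close>, \<open>Y\<close>, \<open>t\<close> by \<open>-\<bar>\<lambda>\<bar>\<close>, \<open>\<bar>Y\<bar>\<close>, \<open>\<bar>t\<bar>\<close> makes all terms of the binomial series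
  nonnegative and dominates the original ones; the majorant sums to \<open>exp (s * \<bar>Y\<bar>)\<close> with
  \<open>s = - ln (1 - \<bar>\<lambda> t\<bar>) / \<bar>\<lambda>\<bar>\<close>, which is integrable as soon as \<open>s < r\<close>.
\<close>

lemma expectation_degen_exp_sums:
  assumes t: "\<bar>lam * t\<bar> < 1" "- ln (1 - \<bar>lam * t\<bar>) / \<bar>lam\<bar> < r"
  shows "(\<lambda>n. (\<integral>\<omega>. degen_ffact lam (Y \<omega>) n \<partial>M) / fact n * t ^ n) sums
         (\<integral>\<omega>. degen_exp lam (Y \<omega>) t \<partial>M)"
proof -
  define s where "s = - ln (1 - \<bar>lam * t\<bar>) / \<bar>lam\<bar>"
  have s: "0 \<le> s" "s < r"
    using t lam by (auto simp: s_def divide_nonpos_pos)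
  define H where "H = (\<lambda>\<omega>. degen_exp (- \<bar>lam\<bar>) \<bar>Y \<omega>\<bar> \<bar>t\<bar>)"
  define f where "f = (\<lambda>n \<omega>. degen_ffact lam (Y \<omega>) n / fact n * t ^ n)"
  define h where "h = (\<lambda>n \<omega>. degen_ffact (- \<bar>lam\<bar>) \<bar>Y \<omega>\<bar> n / fact n * \<bar>t\<bar> ^ n)"
  have H_eq: "H \<omega> = exp (\<bar>Y \<omega>\<bar> * s)" for \<omega>
    using t by (simp add: H_def degen_exp_def powr_def s_def abs_mult)
  have [measurable]: "H \<in> borel_measurable M"
    unfolding H_eq by measurable
  have intH: "integrable M H"
  proof (rule Bochner_Integration.integrable_bound)
    \<comment> \<open>One of the two summands equals
      \<open>exp (\<bar>Y \<omega>\<bar> * s)\<close>, and both \<open>s\<close> and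
      \<open>- s\<close> lie in the range where the moment generating function exists.\<close>
    show "integrable M (\<lambda>\<omega>. exp (Y \<omega> * s) + exp (Y \<omega> * (- s)))"
      using s by (intro Bochner_Integration.integrable_add mgf) auto
    have "H \<omega> \<le> exp (Y \<omega> * s) + exp (Y \<omega> * (- s))" for \<omega>
      by (cases "Y \<omega> \<ge> 0") (simp_all add: H_eq)
    then show "AE \<omega> in M. norm (H \<omega>) \<le> norm (exp (Y \<omega> * s) + exp (Y \<omega> * (- s)))"
      by (intro AE_I2) (simp add: H_eq abs_of_nonneg add_nonneg_nonneg)
  qed measurable
  have h_sums: "(\<lambda>n. h n \<omega>) sums H \<omega>" for \<omega>
    unfolding h_def H_def using lam t(1) by (intro degen_exp_sums) (auto simp: abs_mult)
  have f_le: "norm (f n \<omega>) \<le> h n \<omega>" for n \<omega>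
    unfolding f_def h_def using abs_degen_ffact_le[of lam "Y \<omega>" n]
    by (auto simp: abs_mult power_abs intro!: mult_right_mono divide_right_mono)
  have f_sums: "(\<lambda>n. f n \<omega>) sums degen_exp lam (Y \<omega>) t" for \<omega>
    unfolding f_def by (rule degen_exp_sums[OF lam t(1)])
  have norm_f: "summable (\<lambda>n. norm (f n \<omega>))" for \<omega>
    by (rule summable_comparison_test'[OF sums_summable[OF h_sums[of \<omega>]], of 0]) (simp add: f_le[simplified])
  \<comment> \<open>This bound, uniform in \<open>n\<close>, is used twice: it makes each
    \<open>f n\<close> integrable and bounds the partial sums of the integrals of the norms.\<close>
  have partial: "(\<Sum>i<n. norm (f i \<omega>)) \<le> H \<omega>" for n \<omega>
  proof -
    have "(\<Sum>i<n. norm (f i \<omega>)) \<le> (\<Sum>i<n. h i \<omega>)" by (intro sum_mono f_le)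
    also have "\<dots> \<le> (\<Sum>i. h i \<omega>)"
      using h_sums order.trans[OF norm_ge_zero f_le] by (intro sum_le_suminf) (auto simp: sums_iff)
    finally show ?thesis using h_sums by (simp add: sums_iff)
  qed
  have [measurable]: "f n \<in> borel_measurable M" for n
    unfolding f_def by (intro borel_measurable_times borel_measurable_divide degen_ffact_measurable) auto
  have intf: "integrable M (f n)" for n
  proof (rule Bochner_Integration.integrable_bound[OF intH])
    have "norm (f n \<omega>) \<le> (\<Sum>i<Suc n. norm (f i \<omega>))" for \<omega>
      by (simp add: sum_nonneg)
    from order.trans[OF this partial] have "norm (f n \<omega>) \<le> norm (H \<omega>)" for \<omega>
      by (simp add: H_eq)
    then show "AE \<omega> in M. norm (f n \<omega>) \<le> norm (H \<omega>)" by simp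
  qed measurable
  have sum_int: "summable (\<lambda>i. \<integral>\<omega>. norm (f i \<omega>) \<partial>M)"
  proof (rule summableI_nonneg_bounded)
    fix n
    have "(\<Sum>i<n. \<integral>\<omega>. norm (f i \<omega>) \<partial>M) = (\<integral>\<omega>. (\<Sum>i<n. norm (f i \<omega>)) \<partial>M)"
      using intf by (subst Bochner_Integration.integral_sum) auto
    also have "\<dots> \<le> (\<integral>\<omega>. H \<omega> \<partial>M)"
      using intf intH partial by (intro integral_mono) auto
    finally show "(\<Sum>i<n. \<integral>\<omega>. norm (f i \<omega>) \<partial>M) \<le> (\<integral>\<omega>. H \<omega> \<partial>M)" .
  qed simp
  have "(\<lambda>n. \<integral>\<omega>. f n \<omega> \<partial>M) sums (\<integral>\<omega>. (\<Sum>n. f n \<omega>) \<partial>M)"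
    using intf norm_f sum_int by (intro sums_integral) auto
  also have "(\<lambda>\<omega>. \<Sum>n. f n \<omega>) = (\<lambda>\<omega>. degen_exp lam (Y \<omega>) t)"
    using f_sums by (auto simp: sums_iff)
  finally show ?thesis by (simp add: f_def)
qed

text \<open>This is the series of \<open>F\<close>. Subtracting 1 cancels the zeroth moment, and the
  vanishing constant term allows substitution into another series.\<close>

definition degen_moment_fps :: "real fps" where
  "degen_moment_fps = Abs_fps (\<lambda>n. if n = 0 then 0
     else (\<integral>\<omega>. degen_ffact lam (Y \<omega>) n \<partial>M) / fact n)"

lemma expectation_degen_exp_has_fps_expansion:
  "(\<lambda>t. (\<integral>\<omega>. degen_exp lam (Y \<omega>) t \<partial>M) - 1) has_fps_expansion degen_moment_fps"
proof (rule has_fps_expansionI)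
  have "((\<lambda>t. \<bar>lam * t\<bar>) \<longlongrightarrow> \<bar>lam * 0\<bar>) (nhds 0)"
    by (intro tendsto_intros filterlim_ident)
  then have ev1: "eventually (\<lambda>t. \<bar>lam * t\<bar> < 1) (nhds 0)"
    by (rule order_tendstoD) simp
  \<comment> \<open>The exponent of the majorant tends to 0 with \<open>t\<close>, so it is below
    \<open>r\<close> near 0.\<close>
  have "((\<lambda>t. - ln (1 - \<bar>lam * t\<bar>) / \<bar>lam\<bar>) \<longlongrightarrow> - ln (1 - \<bar>lam * 0\<bar>) / \<bar>lam\<bar>) (nhds 0)"
    using lam by (intro tendsto_intros filterlim_ident) auto
  then have ev2: "eventually (\<lambda>t. - ln (1 - \<bar>lam * t\<bar>) / \<bar>lam\<bar> < r) (nhds 0)"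
    using r by (intro order_tendstoD) auto
  from ev1 ev2 show "eventually (\<lambda>t. (\<lambda>n. fps_nth degen_moment_fps n * t ^ n) sums
      ((\<integral>\<omega>. degen_exp lam (Y \<omega>) t \<partial>M) - 1)) (nhds 0)"
  proof eventually_elim
    case (elim t)
    interpret prob_space M by (rule prob)
    let ?a = "\<lambda>n. (\<integral>\<omega>. degen_ffact lam (Y \<omega>) n \<partial>M) / fact n * t ^ n"
    \<comment> \<open>Total mass 1 makes the constant term exactly the subtracted 1.\<close>
    have "?a 0 = 1" by (simp add: prob_space)
    with expectation_degen_exp_sums[OF elim]
    have "(\<lambda>n. ?a (Suc n)) sums ((\<integral>\<omega>. degen_exp lam (Y \<omega>) t \<partial>M) - 1)"
      by (subst sums_Suc_iff) simp
    then have "(\<lambda>n. fps_nth degen_moment_fps (Suc n) * t ^ Suc n) sums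
                 ((\<integral>\<omega>. degen_exp lam (Y \<omega>) t \<partial>M) - 1)"
      by (simp add: degen_moment_fps_def)
    then show ?case
      by (intro sums_Suc_imp[of "\<lambda>n. fps_nth degen_moment_fps n * t ^ n"]) (simp_all add: degen_moment_fps_def)
  qed
qed

section \<open>The generating function of the poly-Bell polynomials\<close>

definition poly_Bell_fps :: "int \<Rightarrow> real \<Rightarrow> real fps" where
  "poly_Bell_fps k x = fps_compose (degen_poly_Ei_fps k lam) (fps_const x * degen_moment_fps)"

lemma poly_Bell_has_fps_expansion:
  "(\<lambda>t. degen_poly_Ei k lam (x * ((\<integral>\<omega>. degen_exp lam (Y \<omega>) t \<partial>M) - 1)))
     has_fps_expansion poly_Bell_fps k x"
  unfolding poly_Bell_fps_def
  by (intro has_fps_expansion_compose_real degen_poly_Ei_has_fps_expansion lam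
      has_fps_expansion_cmult_left expectation_degen_exp_has_fps_expansion)
    (simp add: degen_moment_fps_def)

text \<open>Resolving the definite description takes existence, from the composed expansion, and
  uniqueness, from uniqueness of expansions for positive indices and from the convention at index
  0.\<close>

lemma prob_degen_poly_Bell_eq:
  assumes "m > 0"
  shows "prob_degen_poly_Bell M Y lam k m x = fact m * fps_nth (poly_Bell_fps k x) m"
proof -
  define B where "B = (\<lambda>m. if m = 0 then 1 else fact m * fps_nth (poly_Bell_fps k x) m)"
  let ?A = "\<lambda>B :: nat \<Rightarrow> real. Abs_fps (\<lambda>m. if m = 0 then 0 else B m / fact m)"
  have "fps_nth (poly_Bell_fps k x) 0 = 0"
    by (simp add: poly_Bell_fps_def degen_poly_Ei_fps_def)
  then have A: "?A B = poly_Bell_fps k x"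
    by (intro fps_ext) (simp add: B_def)
  have "(THE B :: nat \<Rightarrow> real. B 0 = 1 \<and>
        (\<lambda>t. degen_poly_Ei k lam (x * ((\<integral>\<omega>. degen_exp lam (Y \<omega>) t \<partial>M) - 1)))
          has_fps_expansion ?A B) = B"
  proof (rule the_equality, goal_cases)
    case 1
    then show ?case using poly_Bell_has_fps_expansion[of k x] by (simp only: A) (simp add: B_def)
  next
    case (2 B')
    then have "?A B' = ?A B"
      using has_fps_expansion_unique_real[OF _ poly_Bell_has_fps_expansion[of k x]] A by simp
    then have "fps_nth (?A B') m = fps_nth (?A B) m" for m by simp
    then have "B' m = B m" if "m > 0" for m
      using that by (force dest: spec[of _ m])
    moreover have "B' 0 = B 0" using 2 by (simp add: B_def)
    ultimately show "B' = B" by (metis ext neq0_conv)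
  qed
  then show ?thesis
    using assms unfolding prob_degen_poly_Bell_def by (simp add: B_def)
qed

section \<open>The differential identity and its coefficients\<close>

text \<open>Both sides are \<open>x * F * F'\<close> times the derivative of the \<open>Ei\<close>
  series composed with \<open>x * F\<close>. Nothing is divided by \<open>x\<close>, so
  \<open>x = 0\<close> is covered.\<close>

lemma poly_Bell_fps_deriv:
  "poly_Bell_fps (k - 1) x * fps_deriv degen_moment_fps =
   fps_deriv (poly_Bell_fps k x) * degen_moment_fps"
proof -
  let ?D = "fps_const x * degen_moment_fps"
  have D0: "fps_nth ?D 0 = 0" by (simp add: degen_moment_fps_def)
  have "poly_Bell_fps (k - 1) x = ?D * fps_compose (fps_deriv (degen_poly_Ei_fps k lam)) ?D"
    unfolding poly_Bell_fps_def degen_poly_Ei_fps_pred fps_compose_mult_distrib[OF D0]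
    using D0 by simp
  moreover have "fps_deriv (poly_Bell_fps k x) =
      fps_compose (fps_deriv (degen_poly_Ei_fps k lam)) ?D * (fps_const x * fps_deriv degen_moment_fps)"
    unfolding poly_Bell_fps_def fps_compose_deriv[OF D0] by simp
  ultimately show ?thesis by (simp add: mult_ac)
qed

lemma poly_Bell_convolution:
  assumes "n \<ge> 1"
  shows "(\<Sum>m = 1..n. real (n choose m) * prob_degen_poly_Bell M Y lam (k - 1) m x *
            (\<integral>\<omega>. Y \<omega> * degen_ffact lam (Y \<omega> - lam) (n - m) \<partial>M)) =
         (\<Sum>m = 0..n - 1. real (n choose m) * prob_degen_poly_Bell M Y lam k (m + 1) x *
            (\<integral>\<omega>. degen_ffact lam (Y \<omega>) (n - m) \<partial>M))" (is "?L = ?R")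
proof -
  let ?D = degen_moment_fps
  have "?L = (\<Sum>m = 1..n. fact n * (fps_nth (poly_Bell_fps (k - 1) x) m * fps_nth (fps_deriv ?D) (n - m)))"
  proof (rule sum.cong, rule refl)
    fix m assume m: "m \<in> {1..n}"
    \<comment> \<open>The integrand is the falling factorial of order \<open>n - m + 1\<close>,
      whence a coefficient of the derivative of \<open>?D\<close>.\<close>
    have "(\<integral>\<omega>. Y \<omega> * degen_ffact lam (Y \<omega> - lam) (n - m) \<partial>M) =
          fact (n - m) * fps_nth (fps_deriv ?D) (n - m)"
      by (simp add: degen_moment_fps_def flip: degen_ffact_Suc_shift)
    with m show "real (n choose m) * prob_degen_poly_Bell M Y lam (k - 1) m x *
            (\<integral>\<omega>. Y \<omega> * degen_ffact lam (Y \<omega> - lam) (n - m) \<partial>M) =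
       fact n * (fps_nth (poly_Bell_fps (k - 1) x) m * fps_nth (fps_deriv ?D) (n - m))"
      by (simp add: prob_degen_poly_Bell_eq binomial_fact del: fps_deriv_nth)
  qed
  \<comment> \<open>The added term \<open>m = 0\<close> vanishes: the series has constant
    coefficient 0, although the Bell value at index 0 is 1.\<close>
  also have "\<dots> = (\<Sum>m = 0..n. fact n * (fps_nth (poly_Bell_fps (k - 1) x) m * fps_nth (fps_deriv ?D) (n - m)))"
    by (rule sum.mono_neutral_left) (auto simp: poly_Bell_fps_def degen_poly_Ei_fps_def not_le)
  also have "\<dots> = fact n * fps_nth (poly_Bell_fps (k - 1) x * fps_deriv ?D) n"
    by (simp only: fps_mult_nth sum_distrib_left)
  also have "\<dots> = fact n * fps_nth (fps_deriv (poly_Bell_fps k x) * ?D) n"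
    by (simp only: poly_Bell_fps_deriv)
  also have "\<dots> = (\<Sum>m = 0..n. fact n * (fps_nth (fps_deriv (poly_Bell_fps k x)) m * fps_nth ?D (n - m)))"
    by (simp only: fps_mult_nth sum_distrib_left)
  \<comment> \<open>The term \<open>m = n\<close> drops out because \<open>?D\<close> has no
    constant term.\<close>
  also have "\<dots> = (\<Sum>m = 0..n - 1. fact n * (fps_nth (fps_deriv (poly_Bell_fps k x)) m * fps_nth ?D (n - m)))"
    using assms by (intro sum.mono_neutral_right) (auto simp: degen_moment_fps_def)
  also have "\<dots> = ?R"
  proof (rule sum.cong, rule refl)
    fix m assume m: "m \<in> {0..n - 1}"
    with assms have "m < n" by auto
    \<comment> \<open>The factor \<open>m + 1\<close> from differentiation is absorbed by
      \<open>fact (m + 1)\<close>, leaving \<open>fact m\<close> to match the binomial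
      coefficient.\<close>
    have "prob_degen_poly_Bell M Y lam k (m + 1) x = fact m * fps_nth (fps_deriv (poly_Bell_fps k x)) m"
      by (simp add: prob_degen_poly_Bell_eq)
    moreover have "(\<integral>\<omega>. degen_ffact lam (Y \<omega>) (n - m) \<partial>M) = fact (n - m) * fps_nth ?D (n - m)"
      using \<open>m < n\<close> by (simp add: degen_moment_fps_def)
    ultimately show "fact n * (fps_nth (fps_deriv (poly_Bell_fps k x)) m * fps_nth ?D (n - m)) =
       real (n choose m) * prob_degen_poly_Bell M Y lam k (m + 1) x *
            (\<integral>\<omega>. degen_ffact lam (Y \<omega>) (n - m) \<partial>M)"
      using \<open>m < n\<close> by (simp add: binomial_fact del: fps_deriv_nth)
  qed
  finally show ?thesis .
qed

end

theorem theorem2p5: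
  fixes M :: "'a measure" and Y :: "'a \<Rightarrow> real"
    and lam r x :: real and k :: int and n :: nat
  assumes "prob_space M"
    and "Y \<in> borel_measurable M"
    and "r > 0"
    and "\<And>t :: real. \<bar>t\<bar> < r \<Longrightarrow> integrable M (\<lambda>\<omega>. exp (Y \<omega> * t))"
    and "lam \<noteq> 0"
    and "n \<ge> 1"
  shows "(\<Sum>m = 1..n. real (n choose m) * prob_degen_poly_Bell M Y lam (k - 1) m x *
            (\<integral>\<omega>. Y \<omega> * degen_ffact lam (Y \<omega> - lam) (n - m) \<partial>M)) =
         (\<Sum>m = 0..n - 1. real (n choose m) * prob_degen_poly_Bell M Y lam k (m + 1) x *
            (\<integral>\<omega>. degen_ffact lam (Y \<omega>) (n - m) \<partial>M))"
  using assms by (rule poly_Bell_convolution)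

end
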